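(* Suppose $n,m\ge 3$. Then the subring $$R=\mathbb{C}\Big[\Big\{\det\Big(\sum_{i=1}^m c_iX_i\Big) : c_1,\dots,c_m\in\mathbb{C}\Big\}\Big]\subseteq\mathbb{C}[\mathrm{Mat}_n^m]$$ is not the invariant ring for any linear action of any group $G$ on $\mathrm{Mat}_n^m$.
   Context: $\mathrm{Mat}_n^m$ is the complex vector space of $m$-tuples $X=(X_1,\dots,X_m)$ of $n\times n$ complex matrices, and $\mathbb{C}[\mathrm{Mat}_n^m]$ is its ring of polynomial functions; $\det(\sum_i c_iX_i)$ is regarded as a polynomial function of $X$. The ring $R$ is the $\mathbb{C}$-subalgebra generated by these functions. $G$ is an arbitrary group (no reductivity or algebraicity is required), acting through a homomorphism $G\to\mathrm{GL}(\mathrm{Mat}_n^m)$; its invariant ring is $\mathbb{C}[V]^G=\{f\in\mathbb{C}[V] : f(gv)=f(v)\ \forall g\in G, v\in V\}$ with $V=\mathrm{Mat}_n^m$. *)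

theory Defs
  imports "HOL-Analysis.Analysis" "HOL-Algebra.Group"
begin

text \<open>
  The space of \<open>m\<close>-tuples of \<open>n \<times> n\<close> complex matrices is \<open>complex ^ 'n ^ 'n ^ 'm\<close>, where
  \<open>X $ k\<close> is the \<open>k\<close>-th matrix, \<open>n = CARD('n)\<close> and \<open>m = CARD('m)\<close>. The library only
  provides its real vector space structure, so the complex one is introduced here.
\<close>

definition tuple_scale ::
    "complex \<Rightarrow> complex ^ 'n ^ 'n ^ 'm \<Rightarrow> complex ^ 'n ^ 'n ^ 'm" where
  "tuple_scale a X = (\<chi> k i j. a * X $ k $ i $ j)"

lemma vector_space_tuple_scale:
  "vector_space (tuple_scale :: complex \<Rightarrow> complex ^ 'n ^ 'n ^ 'm \<Rightarrow> _)"
  by unfold_locales (simp_all add: tuple_scale_def vec_eq_iff algebra_simps)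

definition GL_tuples :: "(complex ^ 'n ^ 'n ^ 'm \<Rightarrow> complex ^ 'n ^ 'n ^ 'm) monoid" where
  "GL_tuples =
     \<lparr>carrier = {f. Vector_Spaces.linear tuple_scale tuple_scale f \<and> bij f},
      mult = (\<circ>), one = id\<rparr>"

lemma group_GL_tuples: "group (GL_tuples :: (complex ^ 'n ^ 'n ^ 'm \<Rightarrow> _) monoid)"
proof (rule groupI)
  interpret vector_space_pair
    "tuple_scale :: complex \<Rightarrow> complex ^ 'n ^ 'n ^ 'm \<Rightarrow> _"
    "tuple_scale :: complex \<Rightarrow> complex ^ 'n ^ 'n ^ 'm \<Rightarrow> _"
    by (simp add: vector_space_pair_def vector_space_tuple_scale)
  fix f :: "complex ^ 'n ^ 'n ^ 'm \<Rightarrow> complex ^ 'n ^ 'n ^ 'm"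
  assume "f \<in> carrier GL_tuples"
  then have f: "Vector_Spaces.linear tuple_scale tuple_scale f" "bij f"
    by (simp_all add: GL_tuples_def)
  define h where "h = inv_into UNIV f"
  have hf: "h (f x) = x" and fh: "f (h x) = x" for x
    using f(2) by (simp_all add: h_def bij_is_inj bij_is_surj surj_f_inv_f)
  have "Vector_Spaces.linear tuple_scale tuple_scale h"
    unfolding Vector_Spaces.linear_iff
  proof (intro conjI allI)
    fix a and x y :: "complex ^ 'n ^ 'n ^ 'm"
    have "h (x + y) = h (f (h x + h y))"
      by (simp only: linear_add[OF f(1)] fh)
    then show "h (x + y) = h x + h y"
      by (simp only: hf)
    have "h (tuple_scale a x) = h (f (tuple_scale a (h x)))"
      by (simp only: linear_scale[OF f(1)] fh)
    then show "h (tuple_scale a x) = tuple_scale a (h x)"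
      by (simp only: hf)
  qed (rule vector_space_tuple_scale)+
  moreover have "bij h"
    using f(2) by (simp add: h_def bij_imp_bij_inv)
  ultimately have "h \<in> carrier GL_tuples"
    by (simp add: GL_tuples_def)
  moreover have "h \<circ> f = id"
    using hf by auto
  ultimately show "\<exists>g\<in>carrier GL_tuples. g \<otimes>\<^bsub>GL_tuples\<^esub> f = \<one>\<^bsub>GL_tuples\<^esub>"
    by (auto simp: GL_tuples_def)
qed (auto simp: GL_tuples_def bij_comp comp_assoc vector_space.linear_id
       vector_space_tuple_scale intro: Vector_Spaces.linear_compose)

text \<open>The \<open>\<complex>\<close>-subalgebra of the functions \<open>'v \<Rightarrow> \<complex>\<close> generated by \<open>S\<close>.\<close>

inductive_set generated_algebra :: "('v \<Rightarrow> complex) set \<Rightarrow> ('v \<Rightarrow> complex) set"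
  for S :: "('v \<Rightarrow> complex) set" where
  const: "(\<lambda>_. a) \<in> generated_algebra S"
| gen: "f \<in> S \<Longrightarrow> f \<in> generated_algebra S"
| add: "f \<in> generated_algebra S \<Longrightarrow> g \<in> generated_algebra S \<Longrightarrow>
    (\<lambda>v. f v + g v) \<in> generated_algebra S"
| mult: "f \<in> generated_algebra S \<Longrightarrow> g \<in> generated_algebra S \<Longrightarrow>
    (\<lambda>v. f v * g v) \<in> generated_algebra S"

definition polynomial_functions :: "(complex ^ 'n ^ 'n ^ 'm \<Rightarrow> complex) set" where
  "polynomial_functions = generated_algebra {f. \<exists>k i j. f = (\<lambda>X. X $ k $ i $ j)}"

definition lin_comb :: "complex ^ 'm \<Rightarrow> complex ^ 'n ^ 'n ^ 'm \<Rightarrow> complex ^ 'n ^ 'n" where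
  "lin_comb c X = (\<chi> i j. \<Sum>k\<in>UNIV. c $ k * X $ k $ i $ j)"

definition det_ring :: "(complex ^ 'n ^ 'n ^ 'm \<Rightarrow> complex) set" where
  "det_ring = generated_algebra {f. \<exists>c. f = (\<lambda>X. det (lin_comb c X))}"

definition invariant_ring ::
    "('g, 'b) monoid_scheme \<Rightarrow> ('g \<Rightarrow> complex ^ 'n ^ 'n ^ 'm \<Rightarrow> complex ^ 'n ^ 'n ^ 'm) \<Rightarrow>
     (complex ^ 'n ^ 'n ^ 'm \<Rightarrow> complex) set" where
  "invariant_ring G \<rho> =
     {f \<in> polynomial_functions. \<forall>g\<in>carrier G. \<forall>v. f (\<rho> g v) = f v}"

lemma generated_algebra_sum:
  assumes "\<And>i. i \<in> I \<Longrightarrow> f i \<in> generated_algebra S"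
  shows "(\<lambda>v. \<Sum>i\<in>I. f i v) \<in> generated_algebra S"
  using assms
  by (induction I rule: infinite_finite_induct) (auto intro: generated_algebra.intros)

lemma generated_algebra_prod:
  assumes "\<And>i. i \<in> I \<Longrightarrow> f i \<in> generated_algebra S"
  shows "(\<lambda>v. \<Prod>i\<in>I. f i v) \<in> generated_algebra S"
  using assms
  by (induction I rule: infinite_finite_induct) (auto intro: generated_algebra.intros)

lemma det_ring_subset:
  "(det_ring :: (complex ^ 'n ^ 'n ^ 'm \<Rightarrow> complex) set) \<subseteq> polynomial_functions"
proof
  fix f :: "complex ^ 'n ^ 'n ^ 'm \<Rightarrow> complex"
  assume "f \<in> det_ring"
  then show "f \<in> polynomial_functions"
    unfolding det_ring_def polynomial_functions_def
  proof induction
    case (gen f)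
    then show ?case
      by (auto simp: det_def lin_comb_def
          intro!: generated_algebra_sum generated_algebra_prod
            generated_algebra.mult generated_algebra.const
          intro: generated_algebra.gen)
  qed (auto intro: generated_algebra.intros)
qed

end

theory Submission
  imports Defs "HOL-Computational_Algebra.Polynomial"
begin

text \<open>
  A linear bijection of tuples that preserves all the functions \<open>det (\<Sum>\<^sub>i c\<^sub>i X\<^sub>i)\<close> acts on every
  component by one and the same linear map \<open>\<phi>\<close> preserving \<open>det\<close>, since a matrix \<open>N\<close> with
  \<open>det (M + N) = det M\<close> for all \<open>M\<close> is zero. Expanding \<open>det (A + t B)\<close> shows that \<open>\<phi>\<close> preserves
  \<open>trace (A\<^sup>-\<^sup>1 B)\<close> and \<open>trace (A\<^sup>-\<^sup>1 B A\<^sup>-\<^sup>1 B)\<close>, and hence, by polarisation and density of the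
  invertible matrices, \<open>trace (adj A B adj C B)\<close>. If the determinants generated an invariant ring,
  this quartic in three of the components would therefore belong to it. But every generator vanishes
  at a tuple of three independent skew-symmetric \<open>3 \<times> 3\<close> matrices (padded by identity blocks),
  as it does at \<open>0\<close>, whereas the quartic vanishes at \<open>0\<close> and not at that tuple.
\<close>

section \<open>Scalar matrices and the trace\<close>

lemma mat_mult_nth: "(mat (t::'a::comm_ring_1) ** A) $ i $ j = t * A $ i $ j"
  by (simp add: matrix_matrix_mult_def mat_def if_distrib [of "\<lambda>x. x * _"] cong: if_cong)

lemma mat_mult_commute: "mat (t::'a::comm_ring_1) ** A = A ** mat t"
  by (simp add: vec_eq_iff mat_mult_nth)
    (simp add: matrix_matrix_mult_def mat_def if_distrib [of "\<lambda>x. _ * x"] mult.commute cong: if_cong)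

lemma matrix_add_rdistrib: "(A + B) ** C = A ** C + B ** (C :: 'a::semiring_1^'n^'m)"
  by (simp add: vec_eq_iff matrix_matrix_mult_def distrib_right sum.distrib)

lemma matrix_sub_rdistrib: "(A - B) ** C = A ** C - B ** (C :: 'a::ring_1^'n^'m)"
  by (simp add: vec_eq_iff matrix_matrix_mult_def left_diff_distrib sum_subtractf)

lemma mat_mult_left_commute: "A ** (mat (t::'a::comm_ring_1) ** B) = mat t ** (A ** B)"
  by (simp only: matrix_mul_assoc mat_mult_commute [of t A])

lemma mat_mult_mat: "mat (s::'a::comm_ring_1) ** mat t = mat (s * t)"
  by (simp add: vec_eq_iff mat_mult_nth) (simp add: mat_def)

lemma trace_mat_mult: "trace (mat (t::'a::comm_ring_1) ** A) = t * trace A"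
  by (simp add: trace_def mat_mult_nth sum_distrib_left)

text \<open>Nondegeneracy of the trace form, tested on matrix units.\<close>

lemma trace_mult_eq_0_imp_eq_0:
  fixes K :: "'a::comm_ring_1^'n^'n"
  assumes "\<And>N. trace (K ** N) = 0"
  shows "K = 0"
proof -
  have "K $ i $ j = 0" for i j
  proof -
    let ?N = "(\<chi> k l. if k = j \<and> l = i then 1 else 0) :: 'a^'n^'n"
    have "(K ** ?N) $ k $ k = (if k = i then K $ i $ j else 0)" for k
      by (auto simp: matrix_matrix_mult_def if_distrib [of "\<lambda>x. _ * x"] cong: if_cong)
    then have "trace (K ** ?N) = K $ i $ j"
      by (simp add: trace_def)
    with assms show ?thesis by metis
  qed
  then show ?thesis by (simp add: vec_eq_iff)
qed

lemma det_nz_if_right_inverse: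
  fixes A :: "'a::field^'n^'n"
  assumes "A ** L = mat 1"
  shows "det A \<noteq> 0"
  using assms invertible_det_nz invertible_right_inverse by blast

section \<open>Traces recovered from determinants\<close>

text \<open>In the Leibniz expansion a permutation other than \<open>id\<close> moves at least two
  points, so its product has two factors vanishing at \<open>t = 0\<close> and derivative zero
  there; \<open>id\<close> contributes the trace.\<close>

lemma has_field_derivative_det_mat_1:
  fixes M :: "complex^'n^'n"
  shows "((\<lambda>t. det (mat 1 + mat t ** M)) has_field_derivative trace M) (at 0)"
proof -
  let ?P = "{p. p permutes (UNIV :: 'n set)}"
  let ?f = "\<lambda>p i t. mat 1 $ i $ p i + t * M $ i $ p i"
  let ?D = "\<lambda>p. \<Sum>i\<in>UNIV. M $ i $ p i * (\<Prod>j\<in>UNIV - {i}. ?f p j 0)"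
  have "((\<lambda>t. ?f p i t) has_field_derivative M $ i $ p i) (at 0)" for p i
    by (auto intro!: derivative_eq_intros)
  then have "((\<lambda>t. \<Prod>i\<in>UNIV. ?f p i t) has_field_derivative ?D p) (at 0)" for p
    by (rule has_field_derivative_prod)
  then have D: "((\<lambda>t. \<Sum>p\<in>?P. of_int (sign p) * (\<Prod>i\<in>UNIV. ?f p i t))
      has_field_derivative (\<Sum>p\<in>?P. of_int (sign p) * ?D p)) (at 0)"
    by (intro DERIV_sum DERIV_cmult)
  have "?D p = 0" if p: "p permutes (UNIV :: 'n set)" "p \<noteq> id" for p
  proof (rule sum.neutral, rule ballI)
    fix i
    obtain k where k: "p k \<noteq> k"
      using p(2) by (auto simp: fun_eq_iff)
    then have "p (p k) \<noteq> p k"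
      using p(1) by (metis permutes_def)
    with k obtain j where "j \<noteq> i" "p j \<noteq> j"
      by metis
    then have "(\<Prod>j\<in>UNIV - {i}. ?f p j 0) = 0"
      by (intro prod_zero bexI [of _ j]) (auto simp: mat_def)
    then show "M $ i $ p i * (\<Prod>j\<in>UNIV - {i}. ?f p j 0) = 0"
      by simp
  qed
  then have "(\<Sum>p\<in>?P. of_int (sign p) * ?D p) = (\<Sum>p\<in>{id}. of_int (sign p) * ?D p)"
    by (intro sum.mono_neutral_right) (auto simp: permutes_id)
  also have "\<dots> = trace M"
    by (simp add: trace_def mat_def sign_id)
  finally show ?thesis
    using D by (simp add: det_def mat_mult_nth)
qed

lemma trace_eq_if_det_eq:
  fixes M N :: "complex^'n^'n"
  assumes "\<And>t. det (mat 1 + mat t ** M) = det (mat 1 + mat t ** N)"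
  shows "trace M = trace N"
  using has_field_derivative_det_mat_1 [of M] has_field_derivative_det_mat_1 [of N]
  by (simp add: assms DERIV_unique)

text \<open>Uses \<open>det (1 + t M) det (1 - t M) = det (1 - t\<^sup>2 M\<^sup>2)\<close> and that every scalar is \<open>-t\<^sup>2\<close>.\<close>

lemma trace_square_eq_if_det_eq:
  fixes M N :: "complex^'n^'n"
  assumes eq: "\<And>t. det (mat 1 + mat t ** M) = det (mat 1 + mat t ** N)"
  shows "trace (M ** M) = trace (N ** N)"
proof (rule trace_eq_if_det_eq)
  fix s :: complex
  define t where "t = csqrt (- s)"
  have s: "s = t * - t"
    unfolding t_def by (metis minus_mult_right power2_csqrt power2_eq_square minus_minus)
  have prod: "(mat 1 + mat t ** K) ** (mat 1 + mat (-t) ** K) = mat 1 + mat s ** (K ** K)"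
    for K :: "complex^'n^'n"
  proof -
    have "mat t ** K ** (mat (-t) ** K) = mat s ** (K ** K)"
      by (metis s mat_mult_mat mat_mult_left_commute matrix_mul_assoc mult.commute)
    moreover have "mat (-t) ** K = - (mat t ** K)"
      by (simp add: vec_eq_iff mat_mult_nth)
    moreover have "(mat 1 + N) ** (mat 1 - N) = mat 1 + N ** (- N)" for N :: "complex^'n^'n"
      by (simp add: matrix_add_rdistrib matrix_add_ldistrib diff_conv_add_uminus del: add_uminus_conv_diff)
    ultimately show ?thesis
      by (metis diff_conv_add_uminus)
  qed
  show "det (mat 1 + mat s ** (M ** M)) = det (mat 1 + mat s ** (N ** N))"
    unfolding prod [symmetric] det_mul eq ..
qed

section \<open>Periods of the determinant\<close>

lemma eq_0_if_det_add_eq: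
  fixes N :: "'a::field^'n^'n"
  assumes eq: "\<And>M. det (M + N) = det M"
  shows "N = 0"
proof (rule ccontr)
  assume "N \<noteq> 0"
  then obtain i j where nz: "N $ i $ j \<noteq> 0"
    by (auto simp: vec_eq_iff)
  \<comment> \<open>Column \<open>j\<close> of \<open>N\<close> put into the identity would give
    determinant \<open>N $ j $ j\<close>, possibly zero. With the permutation matrix
    \<open>P\<close> swapping \<open>i\<close> and \<open>j\<close>, Cramer's lemma gives
    \<open>N $ i $ j * det P\<close> instead.\<close>
  define s where "s = Transposition.transpose i j"
  define P :: "'a^'n^'n" where "P = (\<chi> k l. if k = s l then 1 else 0)"
  have PP: "P ** P = mat 1"
    unfolding P_def matrix_matrix_mult_def
  proof (clarsimp simp: vec_eq_iff mat_def)
    fix k l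
    have "(\<Sum>r\<in>UNIV. (if k = s r then 1 else 0) * (if r = s l then 1 else 0))
        = (\<Sum>r\<in>UNIV. if r = s l then if k = s r then 1 else (0::'a) else 0)"
      by (rule sum.cong) auto
    then show "(k = l \<longrightarrow> (\<Sum>r\<in>UNIV. (if l = s r then 1 else 0) * (if r = s l then 1 else 0)) = (1::'a))
      \<and> (k \<noteq> l \<longrightarrow> (\<Sum>r\<in>UNIV. (if k = s r then 1 else 0) * (if r = s l then 1 else 0)) = (0::'a))"
      by (auto simp: s_def)
  qed
  define x where "x = P *v column j N"
  have Px: "P *v x = column j N"
    by (simp add: x_def matrix_vector_mul_assoc PP)
  have xj: "x $ j = N $ i $ j"
  proof -
    have "x $ j = (\<Sum>l\<in>UNIV. if j = s l then N $ l $ j else 0)"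
      by (simp add: x_def P_def matrix_vector_mult_def column_def if_distrib [of "\<lambda>x. x * _"] cong: if_cong)
    also have "\<dots> = (\<Sum>l\<in>UNIV. if l = i then N $ l $ j else 0)"
      by (rule sum.cong) (auto simp: s_def Transposition.transpose_def)
    finally show ?thesis by simp
  qed
  \<comment> \<open>\<open>T\<close> is invertible and agrees with \<open>N\<close> in column \<open>j\<close>, so that \<open>T - N\<close> is singular.\<close>
  define T where "T = (\<chi> k l. if l = j then (P *v x) $ k else P $ k $ l)"
  have "det T = x $ j * det P"
    unfolding T_def by (rule cramer_lemma)
  then have "det T \<noteq> 0"
    using nz xj det_nz_if_right_inverse [OF PP] by simp
  moreover have "det (T - N) = 0"
    by (rule det_zero_column [of j]) (simp add: T_def Px column_def vec_eq_iff)
  ultimately show False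
    using eq [of "T - N"] by simp
qed

section \<open>The adjugate and the quartic\<close>

text \<open>Cramer's form, polynomial in the entries and so meaningful for singular matrices as
  well.\<close>

definition adjugate :: "'a::comm_ring_1^'n^'n \<Rightarrow> 'a^'n^'n" where
  "adjugate A = (\<chi> i j. det (\<chi> k l. if l = i then (if k = j then 1 else 0) else A $ k $ l))"

lemma adjugate_right_inverse:
  fixes A :: "'a::field^'n^'n"
  assumes "A ** L = mat 1"
  shows "adjugate A = mat (det A) ** L"
proof -
  have "adjugate A $ i $ j = L $ i $ j * det A" for i j
  proof -
    have "(A *v column j L) $ k = (if k = j then 1 else 0)" for k
    proof -
      have "(A *v column j L) $ k = (A ** L) $ k $ j"
        by (simp add: matrix_vector_mult_def matrix_matrix_mult_def column_def)
      then show ?thesis by (simp add: assms mat_def)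
    qed
    then show ?thesis
      using cramer_lemma [of i A "column j L"]
      by (simp add: adjugate_def column_def cong: if_cong)
  qed
  then show ?thesis
    by (simp add: vec_eq_iff mat_mult_nth)
qed

text \<open>\<open>trace (A\<^sup>-\<^sup>1 B C\<^sup>-\<^sup>1 B)\<close> cleared of denominators.
  The name counts the four matrix factors; the degree in the entries is twice the matrix
  size.\<close>

definition adj_quartic :: "'a::comm_ring_1^'n^'n \<Rightarrow> 'a^'n^'n \<Rightarrow> 'a^'n^'n \<Rightarrow> 'a" where
  "adj_quartic A B C = trace (adjugate A ** B ** adjugate C ** B)"

lemma adj_quartic_right_inverse:
  fixes A :: "'a::field^'n^'n"
  assumes "A ** K = mat 1" "C ** L = mat 1"
  shows "adj_quartic A B C = det A * det C * trace (K ** B ** L ** B)"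
proof -
  have "mat (det A) ** K ** B ** (mat (det C) ** L) ** B
      = mat (det A) ** (mat (det C) ** (K ** B ** L ** B))"
    by (simp add: matrix_mul_assoc [symmetric] mat_mult_left_commute [of B "det C" "L ** B"]
        mat_mult_left_commute [of K "det C" "B ** (L ** B)"])
  then show ?thesis
    by (simp add: adj_quartic_def adjugate_right_inverse [OF assms(1)]
        adjugate_right_inverse [OF assms(2)] trace_mat_mult mult.assoc)
qed

section \<open>Continuity and density of the invertible matrices\<close>

lemma isCont_det [continuous_intros]:
  fixes A :: "'b::t2_space \<Rightarrow> 'a::{comm_ring_1,real_normed_field}^'n^'n"
  assumes "\<And>i j. isCont (\<lambda>t. A t $ i $ j) a"
  shows "isCont (\<lambda>t. det (A t)) a"
  unfolding det_def by (intro continuous_intros assms)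

lemma isCont_adj_quartic:
  fixes A :: "'b::t2_space \<Rightarrow> 'a::{comm_ring_1,real_normed_field}^'n^'n"
  assumes "\<And>i j. isCont (\<lambda>t. A t $ i $ j) a" "\<And>i j. isCont (\<lambda>t. C t $ i $ j) a"
  shows "isCont (\<lambda>t. adj_quartic (A t) B (C t)) a"
proof -
  have *: "isCont (\<lambda>t. adjugate (M t) $ i $ j) a"
    if "\<And>i j. isCont (\<lambda>t. M t $ i $ j) a" for M :: "'b \<Rightarrow> 'a^'n^'n" and i j
  proof -
    have "isCont (\<lambda>t. if l = i then if k = j then 1 else 0 else M t $ k $ l) a" for k l
      using that by (cases "l = i") simp_all
    then show ?thesis
      unfolding adjugate_def by (simp add: isCont_det)
  qed
  from * [of A, OF assms(1)] * [of C, OF assms(2)] show ?thesis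
    unfolding adj_quartic_def trace_def matrix_matrix_mult_def
    by (simp add: continuous_intros)
qed

text \<open>A polynomial in \<open>t\<close> that is nonzero somewhere has finitely many zeros. A
  large argument \<open>1 / s\<close> is the witness: \<open>A + mat (1 / s)\<close> is a multiple
  of a matrix near the identity.\<close>

lemma eventually_det_add_mat_nz:
  fixes A :: "complex^'n^'n"
  shows "\<forall>\<^sub>F t in at 0. det (A + mat t) \<noteq> 0"
proof -
  define p where "p = det (\<chi> i j. [:A $ i $ j, if i = j then 1 else 0:])"
  have poly_p: "poly p t = det (A + mat t)" for t
  proof -
    have "poly (of_int k :: complex poly) t = of_int k" for k
      by (simp add: of_int_poly)
    then show ?thesis
      unfolding p_def det_def
      by (auto simp: poly_sum poly_prod mat_def intro!: sum.cong prod.cong)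
  qed
  have "isCont (\<lambda>s. det (mat 1 + mat s ** A)) 0"
    by (intro isCont_det) (auto simp: mat_mult_nth intro!: continuous_intros)
  then have "((\<lambda>s. det (mat 1 + mat s ** A)) \<longlongrightarrow> 1) (at 0)"
    by (simp add: isCont_def)
  then have "\<forall>\<^sub>F s in at 0. det (mat 1 + mat s ** A) \<noteq> 0"
    by (rule tendsto_imp_eventually_ne) simp
  then have "\<forall>\<^sub>F s in at 0. s \<noteq> 0 \<and> det (mat 1 + mat s ** A) \<noteq> 0"
    by (intro eventually_conj) (simp_all add: eventually_at_filter)
  then obtain s where s: "s \<noteq> 0" "det (mat 1 + mat s ** A) \<noteq> 0"
    using eventually_happens' [OF at_neq_bot] by blast
  have "mat 1 + mat s ** A = mat s ** (A + mat (1 / s))"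
    using s(1) by (simp add: matrix_add_ldistrib mat_mult_mat add.commute)
  with s(2) have "poly p (1 / s) \<noteq> 0"
    by (auto simp: poly_p det_mul)
  then have "finite {t. poly p t = 0}"
    by (intro poly_roots_finite) auto
  then have "\<not> 0 islimpt {t. poly p t = 0}"
    by (simp add: islimpt_finite)
  then show ?thesis
    by (simp add: islimpt_iff_eventually poly_p)
qed

section \<open>Linear maps preserving the determinant\<close>

locale det_preserver =
  fixes \<phi> :: "complex^'n^'n \<Rightarrow> complex^'n^'n"
  assumes add: "\<phi> (A + B) = \<phi> A + \<phi> B"
    and scale: "\<phi> (mat t ** A) = mat t ** \<phi> A"
    and surj: "surj \<phi>"
    and det: "det (\<phi> A) = det A"
begin

text \<open>Factoring \<open>A\<close> out of \<open>A + mat t ** B\<close>, and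
  \<open>\<phi> A\<close> out of its image, leaves equal determinants
  \<open>det (mat 1 + mat t ** _)\<close> for all \<open>t\<close>, which fix both traces.\<close>

lemma
  assumes A: "A ** L = mat 1" and \<phi>A: "\<phi> A ** K = mat 1"
  shows trace_inverse: "trace (K ** \<phi> B) = trace (L ** B)"
    and trace_inverse_square: "trace (K ** \<phi> B ** K ** \<phi> B) = trace (L ** B ** L ** B)"
proof -
  have *: "det M * det (mat 1 + mat t ** (J ** N)) = det (M + mat t ** N)"
    if "M ** J = mat 1" for M J N :: "complex^'n^'n" and t
  proof -
    have "M ** (mat 1 + mat t ** (J ** N)) = M + mat t ** (M ** J ** N)"
      by (simp add: matrix_add_ldistrib matrix_mul_assoc [symmetric]
          mat_mult_left_commute [of M t "J ** N"])
    with that show ?thesis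
      by (metis det_mul matrix_mul_lid)
  qed
  have "det A * det (mat 1 + mat t ** (K ** \<phi> B)) = det A * det (mat 1 + mat t ** (L ** B))" for t
    using * [OF A] * [OF \<phi>A] by (metis add scale det)
  then have eq: "det (mat 1 + mat t ** (K ** \<phi> B)) = det (mat 1 + mat t ** (L ** B))" for t
    using det_nz_if_right_inverse [OF A] by simp
  show "trace (K ** \<phi> B) = trace (L ** B)"
    using eq by (rule trace_eq_if_det_eq)
  show "trace (K ** \<phi> B ** K ** \<phi> B) = trace (L ** B ** L ** B)"
    using trace_square_eq_if_det_eq [OF eq] by (simp add: matrix_mul_assoc)
qed

lemma obtain_inverse:
  assumes "A ** L = mat 1"
  obtains K where "\<phi> A ** K = mat 1"
  using det_nz_if_right_inverse [OF assms] det invertible_det_nz invertible_right_inverse by metis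

text \<open>
  Polarises the invariance of \<open>trace (L B L B)\<close> in the inverse matrix \<open>L\<close>: the passage
  from the inverse of \<open>A\<close> to the inverse of \<open>\<phi> A\<close> is linear, being contragredient to \<open>\<phi>\<close>.
\<close>

lemma adj_quartic_invertible:
  assumes nz: "det A \<noteq> 0" "det C \<noteq> 0"
  shows "adj_quartic (\<phi> A) (\<phi> B) (\<phi> C) = adj_quartic A B C"
proof -
  obtain L1 L2 where L: "A ** L1 = mat 1" "C ** L2 = mat 1"
    using nz invertible_det_nz invertible_right_inverse by metis
  obtain K1 K2 where K: "\<phi> A ** K1 = mat 1" "\<phi> C ** K2 = mat 1"
    using L obtain_inverse by metis
  have "det L1 \<noteq> 0"
    using L(1) by (metis det_nz_if_right_inverse matrix_left_right_inverse)
  \<comment> \<open>For small \<open>s\<close> the sum \<open>L1 + mat s ** L2\<close> is still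
    invertible, hence the inverse of some \<open>F\<close>. Taking \<open>s\<close> nonzero allows
    the mixed term, with factor \<open>2 * s\<close>, to be divided out later.\<close>
  have "isCont (\<lambda>s. det (L1 + mat s ** L2)) 0"
    by (intro isCont_det) (auto simp: mat_mult_nth intro!: continuous_intros)
  then have "((\<lambda>s. det (L1 + mat s ** L2)) \<longlongrightarrow> det L1) (at 0)"
    by (simp add: isCont_def)
  then have "\<forall>\<^sub>F s in at 0. det (L1 + mat s ** L2) \<noteq> 0"
    using \<open>det L1 \<noteq> 0\<close> by (rule tendsto_imp_eventually_ne)
  then have "\<forall>\<^sub>F s in at 0. s \<noteq> 0 \<and> det (L1 + mat s ** L2) \<noteq> 0"
    by (intro eventually_conj) (simp_all add: eventually_at_filter)
  then obtain s where s: "s \<noteq> 0" "det (L1 + mat s ** L2) \<noteq> 0"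
    using eventually_happens' [OF at_neq_bot] by blast
  then obtain F where F: "F ** (L1 + mat s ** L2) = mat 1"
    using invertible_det_nz invertible_left_inverse by metis
  obtain K where K': "\<phi> F ** K = mat 1"
    using F obtain_inverse by metis
  \<comment> \<open>By \<open>trace_inverse\<close> both sides pair equally with every
    \<open>\<phi> D\<close>, and these are all matrices.\<close>
  have "K - (K1 + mat s ** K2) = 0"
  proof (rule trace_mult_eq_0_imp_eq_0)
    fix N
    obtain D where D: "N = \<phi> D"
      using surj by (metis surjD)
    have "trace (K ** N) = trace (K1 ** N) + s * trace (K2 ** N)"
      by (simp add: D trace_inverse [OF F K'] trace_inverse [OF L(1) K(1)]
          trace_inverse [OF L(2) K(2)] matrix_add_rdistrib trace_add trace_mat_mult
          matrix_mul_assoc [symmetric])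
    then show "trace ((K - (K1 + mat s ** K2)) ** N) = 0"
      by (simp add: matrix_sub_rdistrib matrix_add_rdistrib trace_add trace_sub trace_mat_mult
          matrix_mul_assoc [symmetric])
  qed
  then have K_eq: "K = K1 + mat s ** K2"
    by simp
  have expand: "trace ((M + mat s ** N) ** D ** (M + mat s ** N) ** D)
     = trace (M ** D ** M ** D) + 2 * s * trace (M ** D ** N ** D)
       + s\<^sup>2 * trace (N ** D ** N ** D)" for M N D :: "complex^'n^'n"
  proof -
    define X Y where "X = M ** D" and "Y = N ** D"
    have "(M + mat s ** N) ** D = X + mat s ** Y"
      by (simp add: X_def Y_def matrix_add_rdistrib matrix_mul_assoc)
    then have "trace ((M + mat s ** N) ** D ** (M + mat s ** N) ** D)
        = trace ((X + mat s ** Y) ** (X + mat s ** Y))"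
      by (metis matrix_mul_assoc)
    also have "\<dots> = trace (X ** X) + 2 * s * trace (X ** Y) + s\<^sup>2 * trace (Y ** Y)"
      by (simp add: matrix_add_ldistrib matrix_add_rdistrib trace_add trace_mat_mult
          matrix_mul_assoc [symmetric] mat_mult_left_commute [of X s Y]
          mat_mult_left_commute [of Y s Y] trace_mul_sym [of Y X] algebra_simps power2_eq_square)
    finally show ?thesis
      by (simp add: X_def Y_def matrix_mul_assoc)
  qed
  \<comment> \<open>The pure squares are already invariant, so the expansion at \<open>F\<close>
    leaves the mixed term.\<close>
  have "trace (K1 ** \<phi> B ** K2 ** \<phi> B) = trace (L1 ** B ** L2 ** B)"
    using trace_inverse_square [OF F K', of B] s(1)
    by (simp add: K_eq expand trace_inverse_square [OF L(1) K(1)] trace_inverse_square [OF L(2) K(2)])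
  then show ?thesis
    by (simp add: adj_quartic_right_inverse [OF L] adj_quartic_right_inverse [OF K] det)
qed

lemma adj_quartic: "adj_quartic (\<phi> A) (\<phi> B) (\<phi> C) = adj_quartic A B C"
proof -
  \<comment> \<open>Both sides are continuous in \<open>t\<close> and agree for small nonzero
    \<open>t\<close>, where the shifted matrices are invertible. Expanding
    \<open>\<phi> (A + mat t)\<close> linearly makes the continuity of \<open>?l\<close>
    visible.\<close>
  let ?l = "\<lambda>t. adj_quartic (\<phi> A + mat t ** \<phi> (mat 1)) (\<phi> B) (\<phi> C + mat t ** \<phi> (mat 1))"
  let ?r = "\<lambda>t. adj_quartic (A + mat t) B (C + mat t)"
  have "\<forall>\<^sub>F t in at 0. ?r t = ?l t"
    using eventually_det_add_mat_nz [of A] eventually_det_add_mat_nz [of C]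
  proof eventually_elim
    case (elim t)
    then show ?case
      using adj_quartic_invertible [of "A + mat t" "C + mat t" B] scale [of t "mat 1"]
      by (simp add: add mat_mult_mat)
  qed
  moreover have "isCont ?l 0"
    by (intro isCont_adj_quartic) (auto simp: mat_mult_nth intro!: continuous_intros)
  moreover have "isCont (\<lambda>t. (M + mat t) $ i $ j) 0" for M :: "complex^'n^'n" and i j
    by (cases "i = j") (auto simp: mat_def intro!: continuous_intros)
  then have "isCont ?r 0"
    by (intro isCont_adj_quartic)
  ultimately have "?l \<midarrow>0\<rightarrow> ?l 0" "?l \<midarrow>0\<rightarrow> ?r 0"
    unfolding isCont_def using tendsto_cong by fast+
  then have "?l 0 = ?r 0"
    by (rule LIM_unique)
  moreover have "mat 0 = (0 :: complex^'n^'n)" "mat 0 ** M = 0" for M :: "complex^'n^'n"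
    by (simp_all add: vec_eq_iff mat_mult_nth mat_def [of 0])
  ultimately show ?thesis by simp
qed

end

section \<open>Reduction of a symmetry of tuples to a single component\<close>

lemma lin_comb_add: "lin_comb c (X + Y) = lin_comb c X + lin_comb c Y"
  by (simp add: lin_comb_def vec_eq_iff distrib_left sum.distrib)

lemma lin_comb_axis: "lin_comb (axis k 1) X = X $ k"
  by (simp add: lin_comb_def vec_eq_iff axis_def if_distrib [of "\<lambda>x. x * _"] cong: if_cong)

lemma lin_comb_diff_axis: "lin_comb (axis k 1 - axis l 1) X = X $ k - X $ l"
proof -
  have "lin_comb (c - d) X = lin_comb c X - lin_comb d X" for c d
    by (simp add: lin_comb_def vec_eq_iff left_diff_distrib sum_subtractf)
  then show ?thesis
    by (simp add: lin_comb_axis)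
qed

text \<open>Linear relations among components survive \<open>F\<close>. The relation
  \<open>axis k 1\<close> makes component \<open>k\<close> of the image depend on component
  \<open>k\<close> alone; \<open>axis k 1 - axis l 1\<close> makes this dependence the same for all
  indices.\<close>

lemma obtain_det_preserver:
  fixes F :: "complex^'n^'n^'m \<Rightarrow> complex^'n^'n^'m"
  assumes lin: "Vector_Spaces.linear tuple_scale tuple_scale F" and surj: "surj F"
    and det: "\<And>c X. det (lin_comb c (F X)) = det (lin_comb c X)"
  obtains \<phi> where "det_preserver \<phi>" "\<And>X k. F X $ k = \<phi> (X $ k)"
proof -
  have F_add: "F (X + Y) = F X + F Y" and F_scale: "F (tuple_scale t X) = tuple_scale t (F X)"
    for t X Y
    using lin by (simp_all add: Vector_Spaces.linear_iff)
  have F_diff: "F (X - Y) = F X - F Y" for X Y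
    using F_add [of "X - Y" Y] by (simp add: algebra_simps)
  \<comment> \<open>Adding \<open>X\<close> leaves \<open>lin_comb c\<close> unchanged, so
    \<open>lin_comb c (F X)\<close> is a period of the determinant; surjectivity of \<open>F\<close>
    and \<open>onto\<close> make the base point \<open>M\<close> arbitrary.\<close>
  have ker: "lin_comb c (F X) = 0"
    if X: "lin_comb c X = 0" and onto: "\<And>M :: complex^'n^'n. \<exists>Z. lin_comb c Z = M" for c X
  proof (rule eq_0_if_det_add_eq)
    fix M :: "complex^'n^'n"
    obtain Z where Z: "lin_comb c (F Z) = M"
      using onto [of M] surj by (metis surjD)
    have "det (lin_comb c (F (Z + X))) = det (lin_comb c (F Z))"
      by (simp add: det lin_comb_add X)
    then show "det (M + lin_comb c (F X)) = det M"
      by (simp add: F_add lin_comb_add Z)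
  qed
  have component: "F X $ k = F Y $ k" if "X $ k = Y $ k" for X Y k
  proof -
    have "lin_comb (axis k 1) (F (X - Y)) = 0"
    proof (rule ker)
      show "lin_comb (axis k 1) (X - Y) = 0"
        using that by (simp add: lin_comb_axis)
      show "\<exists>Z. lin_comb (axis k 1) Z = M" for M :: "complex^'n^'n"
        by (rule exI [of _ "\<chi> k. M"]) (simp add: lin_comb_axis)
    qed
    then show ?thesis
      by (simp add: F_diff lin_comb_axis)
  qed
  have diagonal: "F (\<chi> i. A) $ k = F (\<chi> i. A) $ l" for A :: "complex^'n^'n" and k l
  proof (cases "k = l")
    case False
    have "lin_comb (axis k 1 - axis l 1) (F (\<chi> i. A)) = 0"
    proof (rule ker)
      show "lin_comb (axis k 1 - axis l 1) (\<chi> i. A) = 0"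
        by (simp add: lin_comb_diff_axis)
      show "\<exists>Z. lin_comb (axis k 1 - axis l 1) Z = M" for M :: "complex^'n^'n"
        using False
        by (intro exI [of _ "\<chi> i. if i = k then M else 0"]) (simp add: lin_comb_diff_axis)
    qed
    then show ?thesis
      by (simp add: lin_comb_diff_axis)
  qed simp
  \<comment> \<open>Any index serves, by \<open>diagonal\<close>.\<close>
  fix k0 :: 'm
  define \<phi> where "\<phi> A = F (\<chi> i. A) $ k0" for A
  have F_eq: "F X $ k = \<phi> (X $ k)" for X k
    unfolding \<phi>_def diagonal [of _ k0 k] by (rule component) simp
  have "det_preserver \<phi>"
  proof
    fix A B :: "complex^'n^'n" and t
    have "(\<chi> i. A + B) = (\<chi> i. A) + ((\<chi> i. B) :: complex^'n^'n^'m)"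
      by (simp add: vec_eq_iff)
    then show "\<phi> (A + B) = \<phi> A + \<phi> B"
      by (simp add: \<phi>_def F_add)
    have "(\<chi> i. mat t ** A) = tuple_scale t ((\<chi> i. A) :: complex^'n^'n^'m)"
      by (simp add: vec_eq_iff tuple_scale_def mat_mult_nth)
    then show "\<phi> (mat t ** A) = mat t ** \<phi> A"
      by (simp add: \<phi>_def F_scale) (simp add: vec_eq_iff tuple_scale_def mat_mult_nth)
    show "surj \<phi>"
    proof (rule surjI)
      show "\<phi> (inv_into UNIV F (\<chi> i. M) $ k0) = M" for M
        by (simp add: F_eq [symmetric] surj_f_inv_f surj)
    qed
    show "det (\<phi> A) = det A"
      using det [of "axis k0 1" "\<chi> i. A"] by (simp add: lin_comb_axis \<phi>_def)
  qed
  with F_eq show thesis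
    by (rule that [rotated])
qed

section \<open>Polynomiality of the quartic, and \<open>det_ring\<close> on singular tuples\<close>

lemma adj_quartic_polynomial:
  "(\<lambda>X :: complex^'n^'n^'m. adj_quartic (X $ a) (X $ b) (X $ c)) \<in> polynomial_functions"
proof -
  have coord: "(\<lambda>X. X $ k $ i $ j) \<in> polynomial_functions" for k :: 'm and i j :: 'n
    unfolding polynomial_functions_def by (rule generated_algebra.gen) blast
  note intros = generated_algebra_sum generated_algebra_prod generated_algebra.mult
    generated_algebra.const
  have adj: "(\<lambda>X. adjugate (X $ k) $ i $ j) \<in> polynomial_functions" for k :: 'm and i j :: 'n
  proof -
    have "(\<lambda>X. if v = i then if u = j then 1 else 0 else X $ k $ u $ v) \<in> polynomial_functions"
      for u v :: 'n
      using coord [of k u v]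
      by (cases "v = i") (auto simp: polynomial_functions_def intro: generated_algebra.const)
    then show ?thesis
      by (auto simp: adjugate_def det_def polynomial_functions_def intro!: intros)
  qed
  show ?thesis
    using coord adj
    unfolding adj_quartic_def trace_def matrix_matrix_mult_def polynomial_functions_def
    by (simp add: intros)
qed

text \<open>All generators vanish at both points, so only the constant term of \<open>f\<close>
  remains.\<close>

lemma det_ring_const_on_singular:
  assumes "f \<in> det_ring" "\<And>c. det (lin_comb c X) = 0" "\<And>c. det (lin_comb c Y) = 0"
  shows "f X = f Y"
  using assms(1) unfolding det_ring_def
  by induction (auto simp: assms(2,3))

section \<open>Padded cross product matrices\<close>

text \<open>The cross product with the \<open>p\<close>-th unit vector on the coordinates \<open>p, q, r\<close>, plus the identity
  on the remaining ones.\<close>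

definition cross_mat :: "'n \<Rightarrow> 'n \<Rightarrow> 'n::finite \<Rightarrow> complex^'n^'n" where
  "cross_mat p q r = (\<chi> i j. if i = q \<and> j = r then -1 else if i = r \<and> j = q then 1
     else if i = j \<and> i \<notin> {p, q, r} then 1 else 0)"

text \<open>Row and column \<open>p\<close> vanish, which kills every cofactor except the one at
  \<open>(p, p)\<close>. That one is the determinant of a signed permutation matrix swapping
  \<open>q\<close> and \<open>r\<close>, hence nonzero.\<close>

lemma adjugate_cross_mat:
  fixes p q r :: "'a::finite"
  assumes pqr: "p \<noteq> q" "p \<noteq> r" "q \<noteq> r"
  obtains d where "d \<noteq> 0"
    "adjugate (cross_mat p q r) = (\<chi> i j. if i = p \<and> j = p then d else 0)"
proof -
  let ?M = "cross_mat p q r"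
  let ?R = "\<lambda>(i :: 'a) (j :: 'a). (\<chi> k l. if l = i then (if k = j then 1 else 0) else ?M $ k $ l) :: complex^'a^'a"
  have zero: "?M $ k $ p = 0" "?M $ p $ k = 0" for k
    using pqr by (auto simp: cross_mat_def)
  define N where "N = ?R p p"
  define s where "s = Transposition.transpose q r"
  define u where "u i = (if i = q then -1 else 1 :: complex)" for i
  have N: "N $ i $ j = (if j = s i then u i else 0)" for i j
  proof -
    consider "i = p" | "i = q" | "i = r" | "i \<notin> {p, q, r}" by blast
    then show ?thesis
      using pqr by cases (simp_all add: N_def cross_mat_def s_def u_def)
  qed
  have "(N ** transpose N) $ i $ j = (if i = j then 1 else 0)" for i j
  proof -
    have "(N ** transpose N) $ i $ j
        = (\<Sum>k\<in>UNIV. if k = s i then u i * (if s i = s j then u j else 0) else 0)"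
      unfolding matrix_matrix_mult_def transpose_def vec_lambda_beta
      by (rule sum.cong) (simp_all add: N)
    moreover have "s i = s j \<longleftrightarrow> i = j"
      unfolding s_def by (metis transpose_involutory)
    ultimately show ?thesis
      by (simp add: u_def)
  qed
  then have "N ** transpose N = mat 1"
    by (simp add: vec_eq_iff mat_def)
  then have "det (?R p p) \<noteq> 0"
    unfolding N_def [symmetric] by (rule det_nz_if_right_inverse)
  moreover have "det (?R i j) = 0" if "i \<noteq> p" for i j
    by (rule det_zero_column [of p]) (use that in \<open>auto simp: column_def vec_eq_iff zero\<close>)
  moreover have "det (?R p j) = 0" if "j \<noteq> p" for j
    by (rule det_zero_row [of p]) (use that in \<open>auto simp: row_def vec_eq_iff zero\<close>)
  ultimately have "adjugate ?M $ i $ j = (if i = p \<and> j = p then det (?R p p) else 0)" for i j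
    unfolding adjugate_def by (cases "i = p"; cases "j = p") simp_all
  then show thesis
    by (intro that [OF \<open>det (?R p p) \<noteq> 0\<close>]) (simp add: vec_eq_iff)
qed

text \<open>The adjugates have single nonzero entries \<open>d\<close> at \<open>(p, p)\<close> and
  \<open>e\<close> at \<open>(r, r)\<close>, so the trace collapses to \<open>d * e\<close> times
  the middle matrix's entries at \<open>(p, r)\<close> and \<open>(r, p)\<close>, which are 1 and
  -1.\<close>

lemma adj_quartic_cross_mat:
  fixes p q r :: "'n::finite"
  assumes pqr: "p \<noteq> q" "p \<noteq> r" "q \<noteq> r"
  shows "adj_quartic (cross_mat p q r) (cross_mat q r p) (cross_mat r p q) \<noteq> 0"
proof -
  obtain d where d: "d \<noteq> 0"
    "adjugate (cross_mat p q r) = (\<chi> i j. if i = p \<and> j = p then d else 0)"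
    using adjugate_cross_mat pqr by blast
  obtain e where e: "e \<noteq> 0"
    "adjugate (cross_mat r p q) = (\<chi> i j. if i = r \<and> j = r then e else 0)"
    using adjugate_cross_mat [of r p q] pqr by blast
  have mult: "((\<chi> i j. if i = p \<and> j = p then d else 0) ** B) $ i $ j
      = (if i = p then d * B $ p $ j else 0)" for p d and B :: "complex^'n^'n" and i j
    by (cases "i = p") (simp_all add: matrix_matrix_mult_def if_distrib [of "\<lambda>x. x * _"] cong: if_cong)
  let ?B = "cross_mat q r p"
  have "adj_quartic (cross_mat p q r) ?B (cross_mat r p q)
      = trace ((adjugate (cross_mat p q r) ** ?B) ** (adjugate (cross_mat r p q) ** ?B))"
    by (simp add: adj_quartic_def matrix_mul_assoc)
  also have "\<dots> = (\<Sum>i\<in>UNIV. \<Sum>k\<in>UNIV. (if i = p then d * ?B $ p $ k else 0)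
      * (if k = r then e * ?B $ r $ i else 0))"
    unfolding trace_def d(2) e(2) matrix_matrix_mult_def [of "_ ** _"] by (simp add: mult)
  also have "\<dots> = (\<Sum>i\<in>UNIV. if i = p then d * ?B $ p $ r * (e * ?B $ r $ p) else 0)"
    by (intro sum.cong) (auto simp: if_distrib [of "\<lambda>x. _ * x"] cong: if_cong)
  also have "\<dots> = - d * e"
    using pqr by (simp add: cross_mat_def)
  finally show ?thesis
    using d e by simp
qed

lemma det_cross_mat_comb:
  assumes pqr: "p \<noteq> q" "p \<noteq> r" "q \<noteq> r"
    and A: "\<And>i j. A $ i $ j = \<alpha> * cross_mat p q r $ i $ j + \<beta> * cross_mat q r p $ i $ j
      + \<gamma> * cross_mat r p q $ i $ j"
  shows "det A = 0"
proof (rule ccontr)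
  assume nz: "det A \<noteq> 0"
  \<comment> \<open>The cross product of a vector with itself vanishes.\<close>
  define v where "v = (\<chi> i. if i = p then \<alpha> else if i = q then \<beta> else if i = r then \<gamma> else 0)"
  have "(A *v v) $ i = 0" for i
  proof -
    have "(A *v v) $ i = (\<Sum>j\<in>UNIV. A $ i $ j * v $ j)"
      by (simp add: matrix_vector_mult_def)
    also have "\<dots> = (\<Sum>j\<in>{p, q, r}. A $ i $ j * v $ j)"
      by (rule sum.mono_neutral_right) (auto simp: v_def)
    also have "\<dots> = A $ i $ p * \<alpha> + A $ i $ q * \<beta> + A $ i $ r * \<gamma>"
      using pqr by (simp add: v_def)
    also have "\<dots> = 0"
      using pqr by (auto simp: A cross_mat_def)
    finally show ?thesis .
  qed
  then have "A *v v = 0"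
    by (simp add: vec_eq_iff)
  moreover obtain L where "L ** A = mat 1"
    using nz invertible_det_nz invertible_left_inverse by metis
  ultimately have "v = 0"
    by (metis matrix_vector_mul_assoc matrix_vector_mul_lid matrix_vector_mult_0_right)
  \<comment> \<open>The kernel vector is trivial only if all three coefficients vanish, and then
    \<open>A\<close> is zero.\<close>
  then have "v $ p = 0" "v $ q = 0" "v $ r = 0"
    by simp_all
  then have "A = 0"
    using pqr by (simp add: A v_def vec_eq_iff)
  then have "row p A = 0"
    by (simp add: row_def vec_eq_iff)
  with nz show False
    by (simp add: det_zero_row)
qed

section \<open>Three components and the invariant ring\<close>

lemma obtain_three:
  assumes "CARD('a) \<ge> 3"
  obtains x y z :: 'a where "x \<noteq> y" "x \<noteq> z" "y \<noteq> z"
proof -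
  obtain T :: "'a set" where "card T = 3"
    using assms obtain_subset_with_card_n by metis
  then show thesis
    using that by (auto simp: card_3_iff)
qed

lemma adj_quartic_notin_det_ring:
  fixes a b c :: "'m::finite"
  assumes abc: "a \<noteq> b" "a \<noteq> c" "b \<noteq> c" and n: "CARD('n) \<ge> 3"
  shows "(\<lambda>X :: complex^'n^'n^'m. adj_quartic (X $ a) (X $ b) (X $ c)) \<notin> det_ring"
proof
  assume mem: "(\<lambda>X :: complex^'n^'n^'m. adj_quartic (X $ a) (X $ b) (X $ c)) \<in> det_ring"
  obtain p q r :: 'n where pqr: "p \<noteq> q" "p \<noteq> r" "q \<noteq> r"
    using n by (rule obtain_three)
  \<comment> \<open>Zero in the other components, so every combination of \<open>X\<close> is one of
    the three cross product matrices.\<close>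
  define X :: "complex^'n^'n^'m" where "X = (\<chi> k. if k = a then cross_mat p q r
    else if k = b then cross_mat q r p else if k = c then cross_mat r p q else 0)"
  have "det (lin_comb w X) = 0" for w
  proof (rule det_cross_mat_comb [OF pqr])
    fix i j
    have "lin_comb w X $ i $ j = (\<Sum>k\<in>UNIV. w $ k * X $ k $ i $ j)"
      by (simp add: lin_comb_def)
    also have "\<dots> = (\<Sum>k\<in>{a, b, c}. w $ k * X $ k $ i $ j)"
      by (rule sum.mono_neutral_right) (auto simp: X_def)
    also have "\<dots> = w $ a * cross_mat p q r $ i $ j + w $ b * cross_mat q r p $ i $ j
        + w $ c * cross_mat r p q $ i $ j"
      using abc by (simp add: X_def)
    finally show "lin_comb w X $ i $ j = \<dots>" .
  qed
  moreover have "det (lin_comb w (0 :: complex^'n^'n^'m)) = 0" for w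
  proof -
    have "lin_comb w (0 :: complex^'n^'n^'m) = 0"
      by (simp add: lin_comb_def vec_eq_iff)
    then show ?thesis
      by (simp add: det_zero_row [of undefined] row_def vec_eq_iff)
  qed
  ultimately have "adj_quartic (X $ a) (X $ b) (X $ c) = adj_quartic 0 0 (0 :: complex^'n^'n)"
    using det_ring_const_on_singular [OF mem, of X 0] by simp
  also have "\<dots> = 0"
    by (simp add: adj_quartic_def trace_def matrix_matrix_mult_def)
  finally show False
    using abc adj_quartic_cross_mat [OF pqr] by (simp add: X_def)
qed

theorem theorem1p16:
  fixes G :: "('g, 'b) monoid_scheme"
    and \<rho> :: "'g \<Rightarrow> complex ^ 'n ^ 'n ^ 'm \<Rightarrow> complex ^ 'n ^ 'n ^ 'm"
  assumes "CARD('n) \<ge> 3" and "CARD('m) \<ge> 3"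
    and "group G" and "\<rho> \<in> hom G GL_tuples"
  shows "(det_ring :: (complex ^ 'n ^ 'n ^ 'm \<Rightarrow> complex) set) \<noteq> invariant_ring G \<rho>"
proof
  assume eq: "(det_ring :: (complex ^ 'n ^ 'n ^ 'm \<Rightarrow> complex) set) = invariant_ring G \<rho>"
  obtain a b c :: 'm where abc: "a \<noteq> b" "a \<noteq> c" "b \<noteq> c"
    using assms(2) by (rule obtain_three)
  have "adj_quartic (\<rho> g X $ a) (\<rho> g X $ b) (\<rho> g X $ c) = adj_quartic (X $ a) (X $ b) (X $ c)"
    if g: "g \<in> carrier G" for g X
  proof -
    have "\<rho> g \<in> carrier GL_tuples"
      using assms(4) g by (auto simp: hom_def)
    then have lin: "Vector_Spaces.linear tuple_scale tuple_scale (\<rho> g)" and "surj (\<rho> g)"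
      by (auto simp: GL_tuples_def bij_is_surj)
    \<comment> \<open>By the assumed equality the generators are themselves invariants.\<close>
    moreover have "det (lin_comb w (\<rho> g Y)) = det (lin_comb w Y)" for w Y
    proof -
      have "(\<lambda>X :: complex^'n^'n^'m. det (lin_comb w X)) \<in> det_ring"
        unfolding det_ring_def by (rule generated_algebra.gen) blast
      then show ?thesis
        using g by (simp add: eq invariant_ring_def)
    qed
    ultimately obtain \<phi> where "det_preserver \<phi>" and \<phi>: "\<And>X k. \<rho> g X $ k = \<phi> (X $ k)"
      by (rule obtain_det_preserver) blast
    then show ?thesis
      by (simp add: det_preserver.adj_quartic)
  qed
  then have "(\<lambda>X :: complex^'n^'n^'m. adj_quartic (X $ a) (X $ b) (X $ c)) \<in> invariant_ring G \<rho>"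
    by (simp add: invariant_ring_def adj_quartic_polynomial)
  with adj_quartic_notin_det_ring [OF abc assms(1)] show False
    by (simp add: eq)
qed

end
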